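(* Let $\sigma$ be any subsequence (possibly empty) of $e\,w_l\,w_r\,c$. The Hilbert systems $\mathbf{e}\mathcal{FL}_\sigma[\vee,*,0,1]$, $\mathbf{e}\mathcal{FL}_\sigma[\vee,\wedge,*,0,1]$, $\mathbf{e}\mathcal{FL}_\sigma[\vee,*,\neg_r,\neg_l,0,1]$ and $\mathbf{e}\mathcal{FL}_\sigma[\vee,\wedge,*,\neg_r,\neg_l,0,1]$ are not protoalgebraic.
   Context: Formulas over a language $\Psi\subseteq\{\vee,\wedge,*,\neg_r,\neg_l,0,1\}$ ($\neg_r$ right negation, $\neg_l$ left negation, unary; $\vee,\wedge,*$ binary; $0,1$ constants) are built from countably many variables. A sequent is $\Gamma\Rightarrow\Delta$ with $\Gamma$ a finite (possibly empty) sequence of formulas and $\Delta$ of length at most one ($\emptyset$ = empty sequence). The calculus has axioms $\varphi\Rightarrow\varphi$, $0\Rightarrow\emptyset$, $\emptyset\Rightarrow1$ and rules ($\Gamma,\Pi,\Sigma$ finite sequences, $\Delta$ of length $\le1$): (Cut) from $\Gamma\Rightarrow\varphi$ and $\Sigma,\varphi,\Pi\Rightarrow\Delta$ infer $\Sigma,\Gamma,\Pi\Rightarrow\Delta$; ($\vee\Rightarrow$) from $\Sigma,\varphi,\Gamma\Rightarrow\Delta$ and $\Sigma,\psi,\Gamma\Rightarrow\Delta$ infer $\Sigma,\varphi\vee\psi,\Gamma\Rightarrow\Delta$; ($\Rightarrow\vee$) from $\Gamma\Rightarrow\varphi$ infer $\Gamma\Rightarrow\varphi\vee\psi$ and $\Gamma\Rightarrow\psi\vee\varphi$;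 ($\wedge\Rightarrow$) from $\Sigma,\varphi,\Gamma\Rightarrow\Delta$ infer $\Sigma,\varphi\wedge\psi,\Gamma\Rightarrow\Delta$ and $\Sigma,\psi\wedge\varphi,\Gamma\Rightarrow\Delta$; ($\Rightarrow\wedge$) from $\Gamma\Rightarrow\varphi$, $\Gamma\Rightarrow\psi$ infer $\Gamma\Rightarrow\varphi\wedge\psi$; ($*\Rightarrow$) from $\Sigma,\varphi,\psi,\Gamma\Rightarrow\Delta$ infer $\Sigma,\varphi*\psi,\Gamma\Rightarrow\Delta$; ($\Rightarrow*$) from $\Gamma\Rightarrow\varphi$, $\Pi\Rightarrow\psi$ infer $\Gamma,\Pi\Rightarrow\varphi*\psi$; ($\neg_r\Rightarrow$) from $\Gamma\Rightarrow\varphi$ infer $\Gamma,\neg_r\varphi\Rightarrow\emptyset$; ($\Rightarrow\neg_r$) from $\varphi,\Gamma\Rightarrow\emptyset$ infer $\Gamma\Rightarrow\neg_r\varphi$; ($\neg_l\Rightarrow$) from $\Gamma\Rightarrow\varphi$ infer $\neg_l\varphi,\Gamma\Rightarrow\emptyset$; ($\Rightarrow\neg_l$) from $\Gamma,\varphi\Rightarrow\emptyset$ infer $\Gamma\Rightarrow\neg_l\varphi$; ($1\Rightarrow$) from $\Sigma,\Gamma\Rightarrow\Delta$ infer $\Sigma,1,\Gamma\Rightarrow\Delta$; ($\Rightarrow0$) from $\Gamma\Rightarrow\emptyset$ infer $\Gamma\Rightarrow0$; plus, for each letter of $\sigma$: $e$: from $\Gamma,\varphi,\psi,\Pi\Rightarrow\Delta$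 infer $\Gamma,\psi,\varphi,\Pi\Rightarrow\Delta$; $w_l$: from $\Sigma,\Gamma\Rightarrow\Delta$ infer $\Sigma,\varphi,\Gamma\Rightarrow\Delta$; $w_r$: from $\Gamma\Rightarrow\emptyset$ infer $\Gamma\Rightarrow\varphi$; $c$: from $\Sigma,\varphi,\varphi,\Gamma\Rightarrow\Delta$ infer $\Sigma,\varphi,\Gamma\Rightarrow\Delta$. $\mathcal{FL}_\sigma[\Psi]$ uses only $\Psi$-formulas and only the rules for connectives in $\Psi$ (plus structural rules); $\Phi\vdash\varsigma$ iff there is a finite sequence ending in $\varsigma$ each member of which is an axiom instance, in $\Phi$, or obtained from earlier members by a rule instance. The external system $\mathbf{e}\mathcal{FL}_\sigma[\Psi]$ is the Hilbert system on $\Psi$-formulas with $\Sigma\vdash\varphi$ iff $\{\emptyset\Rightarrow\psi:\psi\in\Sigma\}\vdash_{\mathcal{FL}_\sigma[\Psi]}\emptyset\Rightarrow\varphi$. For a theory $T$ (deductively closed set of formulas) of a Hilbert system, its Leibniz congruence $\Omega T$ is the largest congruence $\theta$ of the formula algebra compatible with $T$ (i.e. $\langle\varphi,\psi\rangle\in\theta$ and $\varphi\in T$ imply $\psi\in T$). A Hilbert system is protoalgebraic if $T_1\subseteq T_2$ implies $\Omega T_1\subseteq\Omega T_2$ for all theories $T_1,T_2$. *)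

theory Defs
  imports Main
begin

section \<open>Formulas and languages\<close>

datatype connective = COr | CAnd | CFus | CNegR | CNegL | CZero | COne

datatype fm =
    Var nat
  | Zero  ("\<^bold>0")
  | One  ("\<^bold>1")
  | Or fm fm  (infixr "\<^bold>\<or>" 68)
  | And fm fm  (infixr "\<^bold>\<and>" 69)
  | Fus fm fm  (infixr "\<^bold>*" 70)
  | NegR fm
  | NegL fm

primrec connectives :: "fm \<Rightarrow> connective set" where
  "connectives (Var n) = {}"
| "connectives \<^bold>0 = {CZero}"
| "connectives \<^bold>1 = {COne}"
| "connectives (\<phi> \<^bold>\<or> \<psi>) = insert COr (connectives \<phi> \<union> connectives \<psi>)"
| "connectives (\<phi> \<^bold>\<and> \<psi>) = insert CAnd (connectives \<phi> \<union> connectives \<psi>)"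
| "connectives (\<phi> \<^bold>* \<psi>) = insert CFus (connectives \<phi> \<union> connectives \<psi>)"
| "connectives (NegR \<phi>) = insert CNegR (connectives \<phi>)"
| "connectives (NegL \<phi>) = insert CNegL (connectives \<phi>)"

definition Fm :: "connective set \<Rightarrow> fm set" where
  "Fm \<Psi> = {\<phi>. connectives \<phi> \<subseteq> \<Psi>}"

section \<open>The sequent calculi\<close>

text \<open>The right-hand side, a sequence of length at most one, is an option.\<close>

datatype sequent = Seq "fm list" "fm option"  (infix "\<^bold>\<Rightarrow>" 50)

fun sequent_formulas :: "sequent \<Rightarrow> fm set" where
  "sequent_formulas (\<Gamma> \<^bold>\<Rightarrow> \<Delta>) = set \<Gamma> \<union> set_option \<Delta>"

datatype structural = Exchange | WeakeningL | WeakeningR | Contraction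

inductive axiom_instance :: "sequent \<Rightarrow> bool" where
  identity: "axiom_instance ([\<phi>] \<^bold>\<Rightarrow> Some \<phi>)"
| zeroL: "axiom_instance ([\<^bold>0] \<^bold>\<Rightarrow> None)"
| oneR: "axiom_instance ([] \<^bold>\<Rightarrow> Some \<^bold>1)"

text \<open>\<open>rule_instance \<sigma> Ps s\<close>: the sequent \<open>s\<close> follows from the premises \<open>Ps\<close> by one
  application of a rule.\<close>

inductive rule_instance :: "structural set \<Rightarrow> sequent list \<Rightarrow> sequent \<Rightarrow> bool"
  for \<sigma> :: "structural set" where
  Cut: "rule_instance \<sigma> [\<Gamma> \<^bold>\<Rightarrow> Some \<phi>, \<Sigma> @ [\<phi>] @ \<Pi> \<^bold>\<Rightarrow> \<Delta>] (\<Sigma> @ \<Gamma> @ \<Pi> \<^bold>\<Rightarrow> \<Delta>)"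
| OrL: "rule_instance \<sigma> [\<Sigma> @ [\<phi>] @ \<Gamma> \<^bold>\<Rightarrow> \<Delta>, \<Sigma> @ [\<psi>] @ \<Gamma> \<^bold>\<Rightarrow> \<Delta>] (\<Sigma> @ [\<phi> \<^bold>\<or> \<psi>] @ \<Gamma> \<^bold>\<Rightarrow> \<Delta>)"
| OrR1: "rule_instance \<sigma> [\<Gamma> \<^bold>\<Rightarrow> Some \<phi>] (\<Gamma> \<^bold>\<Rightarrow> Some (\<phi> \<^bold>\<or> \<psi>))"
| OrR2: "rule_instance \<sigma> [\<Gamma> \<^bold>\<Rightarrow> Some \<phi>] (\<Gamma> \<^bold>\<Rightarrow> Some (\<psi> \<^bold>\<or> \<phi>))"
| AndL1: "rule_instance \<sigma> [\<Sigma> @ [\<phi>] @ \<Gamma> \<^bold>\<Rightarrow> \<Delta>] (\<Sigma> @ [\<phi> \<^bold>\<and> \<psi>] @ \<Gamma> \<^bold>\<Rightarrow> \<Delta>)"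
| AndL2: "rule_instance \<sigma> [\<Sigma> @ [\<phi>] @ \<Gamma> \<^bold>\<Rightarrow> \<Delta>] (\<Sigma> @ [\<psi> \<^bold>\<and> \<phi>] @ \<Gamma> \<^bold>\<Rightarrow> \<Delta>)"
| AndR: "rule_instance \<sigma> [\<Gamma> \<^bold>\<Rightarrow> Some \<phi>, \<Gamma> \<^bold>\<Rightarrow> Some \<psi>] (\<Gamma> \<^bold>\<Rightarrow> Some (\<phi> \<^bold>\<and> \<psi>))"
| FusL: "rule_instance \<sigma> [\<Sigma> @ [\<phi>, \<psi>] @ \<Gamma> \<^bold>\<Rightarrow> \<Delta>] (\<Sigma> @ [\<phi> \<^bold>* \<psi>] @ \<Gamma> \<^bold>\<Rightarrow> \<Delta>)"
| FusR: "rule_instance \<sigma> [\<Gamma> \<^bold>\<Rightarrow> Some \<phi>, \<Pi> \<^bold>\<Rightarrow> Some \<psi>] (\<Gamma> @ \<Pi> \<^bold>\<Rightarrow> Some (\<phi> \<^bold>* \<psi>))"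
| NegRL: "rule_instance \<sigma> [\<Gamma> \<^bold>\<Rightarrow> Some \<phi>] (\<Gamma> @ [NegR \<phi>] \<^bold>\<Rightarrow> None)"
| NegRR: "rule_instance \<sigma> [[\<phi>] @ \<Gamma> \<^bold>\<Rightarrow> None] (\<Gamma> \<^bold>\<Rightarrow> Some (NegR \<phi>))"
| NegLL: "rule_instance \<sigma> [\<Gamma> \<^bold>\<Rightarrow> Some \<phi>] ([NegL \<phi>] @ \<Gamma> \<^bold>\<Rightarrow> None)"
| NegLR: "rule_instance \<sigma> [\<Gamma> @ [\<phi>] \<^bold>\<Rightarrow> None] (\<Gamma> \<^bold>\<Rightarrow> Some (NegL \<phi>))"
| OneL: "rule_instance \<sigma> [\<Sigma> @ \<Gamma> \<^bold>\<Rightarrow> \<Delta>] (\<Sigma> @ [\<^bold>1] @ \<Gamma> \<^bold>\<Rightarrow> \<Delta>)"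
| ZeroR: "rule_instance \<sigma> [\<Gamma> \<^bold>\<Rightarrow> None] (\<Gamma> \<^bold>\<Rightarrow> Some \<^bold>0)"
| e: "Exchange \<in> \<sigma> \<Longrightarrow>
    rule_instance \<sigma> [\<Gamma> @ [\<phi>, \<psi>] @ \<Pi> \<^bold>\<Rightarrow> \<Delta>] (\<Gamma> @ [\<psi>, \<phi>] @ \<Pi> \<^bold>\<Rightarrow> \<Delta>)"
| wl: "WeakeningL \<in> \<sigma> \<Longrightarrow> rule_instance \<sigma> [\<Sigma> @ \<Gamma> \<^bold>\<Rightarrow> \<Delta>] (\<Sigma> @ [\<phi>] @ \<Gamma> \<^bold>\<Rightarrow> \<Delta>)"
| wr: "WeakeningR \<in> \<sigma> \<Longrightarrow> rule_instance \<sigma> [\<Gamma> \<^bold>\<Rightarrow> None] (\<Gamma> \<^bold>\<Rightarrow> Some \<phi>)"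
| c: "Contraction \<in> \<sigma> \<Longrightarrow>
    rule_instance \<sigma> [\<Sigma> @ [\<phi>, \<phi>] @ \<Gamma> \<^bold>\<Rightarrow> \<Delta>] (\<Sigma> @ [\<phi>] @ \<Gamma> \<^bold>\<Rightarrow> \<Delta>)"

text \<open>A derivation in the \<open>\<Psi>\<close>-calculus consists of sequents of \<open>\<Psi>\<close>-formulas only. This also
  restricts it to the axioms and rules for the connectives in \<open>\<Psi>\<close>: every logical rule, and each
  of the two axioms for constants, has its connective in the conclusion.\<close>

definition FL_derivation ::
    "structural set \<Rightarrow> connective set \<Rightarrow> sequent set \<Rightarrow> sequent list \<Rightarrow> bool" where
  "FL_derivation \<sigma> \<Psi> \<Phi> ds \<longleftrightarrow>
     (\<forall>i < length ds. sequent_formulas (ds ! i) \<subseteq> Fm \<Psi> \<and>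
        (axiom_instance (ds ! i) \<or> ds ! i \<in> \<Phi> \<or>
         (\<exists>Ps. set Ps \<subseteq> set (take i ds) \<and> rule_instance \<sigma> Ps (ds ! i))))"

definition FL :: "structural set \<Rightarrow> connective set \<Rightarrow> sequent set \<Rightarrow> sequent \<Rightarrow> bool" where
  "FL \<sigma> \<Psi> \<Phi> s \<longleftrightarrow> (\<exists>ds. ds \<noteq> [] \<and> last ds = s \<and> FL_derivation \<sigma> \<Psi> \<Phi> ds)"

definition eFL :: "structural set \<Rightarrow> connective set \<Rightarrow> fm set \<Rightarrow> fm \<Rightarrow> bool" where
  "eFL \<sigma> \<Psi> \<Sigma> \<phi> \<longleftrightarrow>
     \<Sigma> \<subseteq> Fm \<Psi> \<and> \<phi> \<in> Fm \<Psi> \<and> FL \<sigma> \<Psi> {[] \<^bold>\<Rightarrow> Some \<psi> | \<psi>. \<psi> \<in> \<Sigma>} ([] \<^bold>\<Rightarrow> Some \<phi>)"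

section \<open>Leibniz congruences and protoalgebraicity\<close>

text \<open>In the following, a Hilbert system over \<open>\<Psi>\<close> is given by its consequence relation
  \<open>C :: fm set \<Rightarrow> fm \<Rightarrow> bool\<close> on \<open>Fm \<Psi>\<close>.\<close>

definition is_theory :: "connective set \<Rightarrow> (fm set \<Rightarrow> fm \<Rightarrow> bool) \<Rightarrow> fm set \<Rightarrow> bool" where
  "is_theory \<Psi> C T \<longleftrightarrow> T \<subseteq> Fm \<Psi> \<and> (\<forall>\<phi> \<in> Fm \<Psi>. C T \<phi> \<longrightarrow> \<phi> \<in> T)"

definition congruence :: "connective set \<Rightarrow> fm rel \<Rightarrow> bool" where
  "congruence \<Psi> \<theta> \<longleftrightarrow> equiv (Fm \<Psi>) \<theta> \<and>
     (\<forall>\<phi> \<phi>' \<psi> \<psi>'. (\<phi>, \<phi>') \<in> \<theta> \<longrightarrow> (\<psi>, \<psi>') \<in> \<theta> \<longrightarrow>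
        (COr \<in> \<Psi> \<longrightarrow> (\<phi> \<^bold>\<or> \<psi>, \<phi>' \<^bold>\<or> \<psi>') \<in> \<theta>) \<and>
        (CAnd \<in> \<Psi> \<longrightarrow> (\<phi> \<^bold>\<and> \<psi>, \<phi>' \<^bold>\<and> \<psi>') \<in> \<theta>) \<and>
        (CFus \<in> \<Psi> \<longrightarrow> (\<phi> \<^bold>* \<psi>, \<phi>' \<^bold>* \<psi>') \<in> \<theta>)) \<and>
     (\<forall>\<phi> \<phi>'. (\<phi>, \<phi>') \<in> \<theta> \<longrightarrow>
        (CNegR \<in> \<Psi> \<longrightarrow> (NegR \<phi>, NegR \<phi>') \<in> \<theta>) \<and>
        (CNegL \<in> \<Psi> \<longrightarrow> (NegL \<phi>, NegL \<phi>') \<in> \<theta>))"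

definition compatible :: "fm rel \<Rightarrow> fm set \<Rightarrow> bool" where
  "compatible \<theta> T \<longleftrightarrow> (\<forall>\<phi> \<psi>. (\<phi>, \<psi>) \<in> \<theta> \<longrightarrow> \<phi> \<in> T \<longrightarrow> \<psi> \<in> T)"

definition Leibniz :: "connective set \<Rightarrow> fm set \<Rightarrow> fm rel" where
  "Leibniz \<Psi> T = (GREATEST \<theta>. congruence \<Psi> \<theta> \<and> compatible \<theta> T)"

definition protoalgebraic :: "connective set \<Rightarrow> (fm set \<Rightarrow> fm \<Rightarrow> bool) \<Rightarrow> bool" where
  "protoalgebraic \<Psi> C \<longleftrightarrow>
     (\<forall>T1 T2. is_theory \<Psi> C T1 \<longrightarrow> is_theory \<Psi> C T2 \<longrightarrow> T1 \<subseteq> T2 \<longrightarrow>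
        Leibniz \<Psi> T1 \<subseteq> Leibniz \<Psi> T2)"

text \<open>The largest compatible congruence exists, so \<^const>\<open>Leibniz\<close> is well defined.\<close>

lemma congruence_Id: "congruence \<Psi> (Id_on (Fm \<Psi>))"
  unfolding congruence_def equiv_def refl_on_def sym_def trans_def
  by (auto simp: Fm_def)

lemma trancl_lift2:
  assumes "\<And>a b c d. (a, b) \<in> R \<Longrightarrow> (c, d) \<in> R \<Longrightarrow> (f a c, f b d) \<in> R\<^sup>+"
    and refl: "\<And>a b. (a, b) \<in> R \<Longrightarrow> (a, a) \<in> R \<and> (b, b) \<in> R"
    and "(a, b) \<in> R\<^sup>+" "(c, d) \<in> R\<^sup>+"
  shows "(f a c, f b d) \<in> R\<^sup>+"
proof -
  have one: "(f x c, f y c) \<in> R\<^sup>+" if "(x, y) \<in> R" "(c, c) \<in> R" for x y c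
    using assms(1) that by blast
  have two: "(f x c, f x d) \<in> R\<^sup>+" if "(c, d) \<in> R" "(x, x) \<in> R" for x c d
    using assms(1) that by blast
  have cc: "(c, c) \<in> R" using assms(4) refl by (meson tranclD)
  have bb: "(b, b) \<in> R" using assms(3) refl by (meson tranclD2)
  have "(f a c, f b c) \<in> R\<^sup>+"
    using assms(3) by (induction rule: trancl_induct) (metis one cc trancl_trans)+
  moreover have "(f b c, f b d) \<in> R\<^sup>+"
    using assms(4) by (induction rule: trancl_induct) (metis two bb trancl_trans)+
  ultimately show ?thesis by (rule trancl_trans)
qed

lemma trancl_lift1:
  assumes "\<And>a b. (a, b) \<in> R \<Longrightarrow> (f a, f b) \<in> R\<^sup>+" and "(a, b) \<in> R\<^sup>+"
  shows "(f a, f b) \<in> R\<^sup>+"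
  using assms(2) by (induction rule: trancl_induct) (metis assms(1) trancl_trans)+

lemma Leibniz_exists:
  fixes \<Psi> T
  defines "S \<equiv> \<Union>{\<theta>. congruence \<Psi> \<theta> \<and> compatible \<theta> T}"
  shows "congruence \<Psi> (S\<^sup>+)" and "compatible (S\<^sup>+) T"
    and "congruence \<Psi> \<theta> \<Longrightarrow> compatible \<theta> T \<Longrightarrow> \<theta> \<subseteq> S\<^sup>+"
proof -
  have SE: "\<exists>\<theta>. congruence \<Psi> \<theta> \<and> compatible \<theta> T \<and> (a, b) \<in> \<theta>" if "(a, b) \<in> S" for a b
    using that unfolding S_def by blast
  have SI: "(a, b) \<in> S" if "congruence \<Psi> \<theta>" "compatible \<theta> T" "(a, b) \<in> \<theta>" for a b \<theta>
    using that unfolding S_def by blast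
  have field: "a \<in> Fm \<Psi> \<and> b \<in> Fm \<Psi>" if "(a, b) \<in> S" for a b
    using SE[OF that] unfolding congruence_def equiv_def by blast
  have Id: "(a, a) \<in> S" if "a \<in> Fm \<Psi>" for a
    using that by (intro SI[OF congruence_Id]) (auto simp: compatible_def)
  have refl: "(a, a) \<in> S \<and> (b, b) \<in> S" if "(a, b) \<in> S" for a b
    using field[OF that] Id by blast
  have sym: "(b, a) \<in> S" if ab: "(a, b) \<in> S" for a b
  proof -
    obtain \<theta> where \<theta>: "congruence \<Psi> \<theta>" "compatible \<theta> T" "(a, b) \<in> \<theta>" using SE[OF ab] by blast
    then have "(b, a) \<in> \<theta>" unfolding congruence_def equiv_def by (blast dest: symD)
    then show ?thesis using SI \<theta> by blast
  qed
  have lift: "(f a c, f b d) \<in> S\<^sup>+"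
    if f: "\<And>\<theta> a b c d. congruence \<Psi> \<theta> \<Longrightarrow> (a, b) \<in> \<theta> \<Longrightarrow> (c, d) \<in> \<theta> \<Longrightarrow> (f a c, f b d) \<in> \<theta>"
      and "(a, b) \<in> S\<^sup>+" "(c, d) \<in> S\<^sup>+" for f a b c d
  proof (rule trancl_lift2[OF _ _ that(2,3)])
    fix a b c d assume *: "(a, b) \<in> S" "(c, d) \<in> S"
    obtain \<theta> where \<theta>: "congruence \<Psi> \<theta>" "compatible \<theta> T" "(a, b) \<in> \<theta>" using SE *(1) by blast
    obtain \<eta> where \<eta>: "congruence \<Psi> \<eta>" "compatible \<eta> T" "(c, d) \<in> \<eta>" using SE *(2) by blast
    have "(c, c) \<in> \<theta>" "(b, b) \<in> \<eta>"
      using \<theta>(1) \<eta>(1) field *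
      unfolding congruence_def equiv_def refl_on_def by blast+
    then have "(f a c, f b c) \<in> S" "(f b c, f b d) \<in> S"
      using f \<theta> \<eta> SI by blast+
    then show "(f a c, f b d) \<in> S\<^sup>+" by auto
  qed (use refl in blast)
  have lift': "(f a, f b) \<in> S\<^sup>+"
    if "\<And>\<theta> a b. congruence \<Psi> \<theta> \<Longrightarrow> (a, b) \<in> \<theta> \<Longrightarrow> (f a, f b) \<in> \<theta>"
      and "(a, b) \<in> S\<^sup>+" for f a b
    using that(2) by (rule trancl_lift1[rotated]) (use SE SI that(1) in blast)
  have "equiv (Fm \<Psi>) (S\<^sup>+)"
  proof (rule equivI)
    show "S\<^sup>+ \<subseteq> Fm \<Psi> \<times> Fm \<Psi>" by (rule trancl_subset_Sigma) (auto dest: field)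
    show "refl_on (Fm \<Psi>) (S\<^sup>+)" by (rule refl_onI) (use Id in blast)
    show "sym_on UNIV (S\<^sup>+)" by (rule sym_trancl) (use sym in \<open>blast intro: symI\<close>)
    show "trans (S\<^sup>+)" by (rule trans_trancl)
  qed
  moreover have "(a \<^bold>\<or> c, b \<^bold>\<or> d) \<in> S\<^sup>+"
    if "COr \<in> \<Psi>" "(a, b) \<in> S\<^sup>+" "(c, d) \<in> S\<^sup>+" for a b c d
    by (rule lift[OF _ that(2,3)]) (use that(1) in \<open>simp add: congruence_def\<close>)
  moreover have "(a \<^bold>\<and> c, b \<^bold>\<and> d) \<in> S\<^sup>+"
    if "CAnd \<in> \<Psi>" "(a, b) \<in> S\<^sup>+" "(c, d) \<in> S\<^sup>+" for a b c d
    by (rule lift[OF _ that(2,3)]) (use that(1) in \<open>simp add: congruence_def\<close>)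
  moreover have "(a \<^bold>* c, b \<^bold>* d) \<in> S\<^sup>+"
    if "CFus \<in> \<Psi>" "(a, b) \<in> S\<^sup>+" "(c, d) \<in> S\<^sup>+" for a b c d
    by (rule lift[OF _ that(2,3)]) (use that(1) in \<open>simp add: congruence_def\<close>)
  moreover have "(NegR a, NegR b) \<in> S\<^sup>+" if "CNegR \<in> \<Psi>" "(a, b) \<in> S\<^sup>+" for a b
    by (rule lift'[OF _ that(2)]) (use that(1) in \<open>simp add: congruence_def\<close>)
  moreover have "(NegL a, NegL b) \<in> S\<^sup>+" if "CNegL \<in> \<Psi>" "(a, b) \<in> S\<^sup>+" for a b
    by (rule lift'[OF _ that(2)]) (use that(1) in \<open>simp add: congruence_def\<close>)
  ultimately show "congruence \<Psi> (S\<^sup>+)"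
    unfolding congruence_def[of \<Psi> "S\<^sup>+"] by blast
  have "b \<in> T" if "(a, b) \<in> S\<^sup>+" "a \<in> T" for a b
    using that
  proof (induction rule: trancl_induct)
    case (base y)
    then show ?case using SE unfolding compatible_def by blast
  next
    case (step y z)
    then show ?case using SE unfolding compatible_def by blast
  qed
  then show "compatible (S\<^sup>+) T" unfolding compatible_def by blast
  show "\<theta> \<subseteq> S\<^sup>+" if "congruence \<Psi> \<theta>" "compatible \<theta> T"
    using that SI by auto
qed

lemma congruence_Leibniz: "congruence \<Psi> (Leibniz \<Psi> T)"
  and compatible_Leibniz: "compatible (Leibniz \<Psi> T) T"
  and Leibniz_greatest: "congruence \<Psi> \<theta> \<Longrightarrow> compatible \<theta> T \<Longrightarrow> \<theta> \<subseteq> Leibniz \<Psi> T"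
proof -
  let ?S = "(\<Union>{\<theta>. congruence \<Psi> \<theta> \<and> compatible \<theta> T})\<^sup>+"
  have "Leibniz \<Psi> T = ?S"
    unfolding Leibniz_def
  proof (rule Greatest_equality)
    show "congruence \<Psi> ?S \<and> compatible ?S T"
      using Leibniz_exists(1,2) by (rule conjI)
    show "\<theta> \<subseteq> ?S" if "congruence \<Psi> \<theta> \<and> compatible \<theta> T" for \<theta>
      using that by (elim conjE) (rule Leibniz_exists(3))
  qed
  then show "congruence \<Psi> (Leibniz \<Psi> T)" "compatible (Leibniz \<Psi> T) T"
    "congruence \<Psi> \<theta> \<Longrightarrow> compatible \<theta> T \<Longrightarrow> \<theta> \<subseteq> Leibniz \<Psi> T"
    by (simp_all only: Leibniz_exists)
qed

end

theory Submission
  imports Defs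
begin

text \<open>Interpret the formulas in the four-element chain \<open>0 < 1 < 2 < 3\<close>, seen as a Heyting algebra
  in which fusion is meet. It is a model of the strongest calculus, so each principal filter yields a
  theory of every system. Both middle elements have pseudocomplement \<open>0\<close>, so identifying them is a
  congruence of the implication-free reduct. This congruence is compatible with the filter \<open>{3}\<close> but
  not with the larger filter \<open>{2, 3}\<close>.\<close>

primrec chain_val :: "fm \<Rightarrow> nat" where
  "chain_val (Var n) = (if n = 0 then 1 else 2)"
| "chain_val \<^bold>0 = 0"
| "chain_val \<^bold>1 = 3"
| "chain_val (\<phi> \<^bold>\<or> \<psi>) = max (chain_val \<phi>) (chain_val \<psi>)"
| "chain_val (\<phi> \<^bold>\<and> \<psi>) = min (chain_val \<phi>) (chain_val \<psi>)"
| "chain_val (\<phi> \<^bold>* \<psi>) = min (chain_val \<phi>) (chain_val \<psi>)"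
| "chain_val (NegR \<phi>) = (if chain_val \<phi> = 0 then 3 else 0)"
| "chain_val (NegL \<phi>) = (if chain_val \<phi> = 0 then 3 else 0)"

text \<open>On a chain, the meet of \<open>d\<close> and the values of \<open>\<Gamma>\<close> lies below the value of the succedent iff every
  nonzero \<open>t\<close> below the former also lies below the latter. Cutting down by \<open>d\<close> makes the sequents
  without antecedent express membership in the filter generated by \<open>d\<close>.\<close>

fun holds_at :: "nat \<Rightarrow> sequent \<Rightarrow> bool" where
  "holds_at t (\<Gamma> \<^bold>\<Rightarrow> \<Delta>) \<longleftrightarrow>
     (\<forall>\<gamma> \<in> set \<Gamma>. t \<le> chain_val \<gamma>) \<longrightarrow> (\<exists>\<delta> \<in> set_option \<Delta>. t \<le> chain_val \<delta>)"

definition valid_above :: "nat \<Rightarrow> sequent \<Rightarrow> bool" where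
  "valid_above d s \<longleftrightarrow> (\<forall>t. 0 < t \<longrightarrow> t \<le> d \<longrightarrow> holds_at t s)"

lemma holds_at_axiom:
  assumes "0 < t" "t \<le> 3" "axiom_instance s"
  shows "holds_at t s"
  using assms(3,1,2) by cases auto

text \<open>The premises at \<open>1\<close> are needed for the right rules for negation: a pseudocomplement is nonzero
  only if the negated formula has value \<open>0\<close>.\<close>

lemma holds_at_rule:
  assumes t: "0 < t" "t \<le> 3" and rule: "rule_instance \<sigma> Ps s"
    and prem: "\<forall>p \<in> set Ps. holds_at t p" "\<forall>p \<in> set Ps. holds_at 1 p"
  shows "holds_at t s"
proof -
  have pos: "0 < chain_val \<gamma>" if "t \<le> chain_val \<gamma>" for \<gamma>
    using that t by simp
  show ?thesis
    using rule
  proof cases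
    case (NegRR \<phi> \<Gamma>)
    then have "\<not> (0 < chain_val \<phi> \<and> (\<forall>\<gamma> \<in> set \<Gamma>. 0 < chain_val \<gamma>))"
      using prem(2) by (simp add: Suc_le_eq)
    \<comment> \<open>If \<open>\<phi>\<close> has value 0, its negation takes the top value 3;
      otherwise some member of \<open>\<Gamma>\<close> has value 0 and the antecedent fails at
      \<open>t\<close>.\<close>
    then show ?thesis using NegRR(2) t pos by (cases "chain_val \<phi> = 0") (simp, fastforce)
  next
    case (NegLR \<Gamma> \<phi>)
    then have "\<not> (0 < chain_val \<phi> \<and> (\<forall>\<gamma> \<in> set \<Gamma>. 0 < chain_val \<gamma>))"
      using prem(2) by (simp add: Suc_le_eq)
    then show ?thesis using NegLR(2) t pos by (cases "chain_val \<phi> = 0") (simp, fastforce)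
  \<comment> \<open>The structural rules hold because an antecedent is read only as a set, and a
    sequent with empty succedent holds only if its antecedent fails.\<close>
  qed (use t prem(1) in \<open>auto simp: le_max_iff_disj\<close>)
qed

lemma valid_above_rule:
  assumes "d \<le> 3" "rule_instance \<sigma> Ps s" "\<And>p. p \<in> set Ps \<Longrightarrow> valid_above d p"
  shows "valid_above d s"
  unfolding valid_above_def
proof (intro allI impI)
  fix t :: nat assume t: "0 < t" "t \<le> d"
  \<comment> \<open>The test at 1 is available too, since 1 \<le> t \<le> d.\<close>
  then have "\<forall>p \<in> set Ps. holds_at t p" "\<forall>p \<in> set Ps. holds_at 1 p"
    using assms(3) by (simp_all add: valid_above_def)
  then show "holds_at t s" using holds_at_rule[OF _ _ assms(2)] t assms(1) by simp
qed

lemma valid_above_FL: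
  assumes "d \<le> 3" "\<And>p. p \<in> \<Phi> \<Longrightarrow> valid_above d p" "FL \<sigma> \<Psi> \<Phi> s"
  shows "valid_above d s"
proof -
  obtain ds where ds: "ds \<noteq> []" "last ds = s" "FL_derivation \<sigma> \<Psi> \<Phi> ds"
    using assms(3) unfolding FL_def by blast
  have "valid_above d (ds ! i)" if "i < length ds" for i
    using that
  proof (induction i rule: less_induct)
    case (less i)
    consider "axiom_instance (ds ! i)" | "ds ! i \<in> \<Phi>"
      | Ps where "set Ps \<subseteq> set (take i ds)" "rule_instance \<sigma> Ps (ds ! i)"
      using ds(3) less.prems unfolding FL_derivation_def by blast
    then show ?case
    proof cases
      case 3
      have "valid_above d p" if "p \<in> set Ps" for p
        using 3(1) that less by (fastforce simp: in_set_conv_nth)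
      then show ?thesis using valid_above_rule[OF assms(1) 3(2)] by blast
    qed (use assms(1,2) holds_at_axiom in \<open>auto simp: valid_above_def\<close>)
  qed
  then show ?thesis using ds(1,2) by (auto simp: last_conv_nth)
qed

definition filter_theory :: "connective set \<Rightarrow> nat \<Rightarrow> fm set" where
  "filter_theory \<Psi> d = {\<phi> \<in> Fm \<Psi>. d \<le> chain_val \<phi>}"

text \<open>With empty antecedent, the test at \<open>t = d\<close> is the strongest and amounts to
  the succedent lying in the filter, so soundness gives closure.\<close>

lemma is_theory_filter_theory:
  assumes "0 < d" "d \<le> 3"
  shows "is_theory \<Psi> (eFL \<sigma> \<Psi>) (filter_theory \<Psi> d)"
proof -
  have "\<phi> \<in> filter_theory \<Psi> d" if "eFL \<sigma> \<Psi> (filter_theory \<Psi> d) \<phi>" for \<phi>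
  proof -
    have "valid_above d ([] \<^bold>\<Rightarrow> Some \<phi>)"
    proof (rule valid_above_FL[OF assms(2)])
      show "FL \<sigma> \<Psi> {[] \<^bold>\<Rightarrow> Some \<psi> | \<psi>. \<psi> \<in> filter_theory \<Psi> d} ([] \<^bold>\<Rightarrow> Some \<phi>)"
        using that by (simp add: eFL_def)
    qed (auto simp: filter_theory_def valid_above_def)
    then show ?thesis using that assms(1) by (simp add: eFL_def filter_theory_def valid_above_def)
  qed
  moreover have "filter_theory \<Psi> d \<subseteq> Fm \<Psi>"
    by (auto simp: filter_theory_def)
  ultimately show ?thesis unfolding is_theory_def by blast
qed

definition merge_middle :: "nat \<Rightarrow> nat" where
  "merge_middle n = (if n = 2 then 1 else n)"

text \<open>A monotone map between chains preserves joins and meets.\<close>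

lemma merge_middle_max: "merge_middle (max m n) = max (merge_middle m) (merge_middle n)"
  and merge_middle_min: "merge_middle (min m n) = min (merge_middle m) (merge_middle n)"
  by (auto simp: merge_middle_def max_def min_def)

text \<open>Only 0 is sent to 0, and both 0 and 3 are fixed.\<close>

lemma merge_middle_neg:
  "merge_middle (if n = 0 then 3 else 0) = (if merge_middle n = 0 then 3 else 0)"
  by (simp add: merge_middle_def)

definition middle_congruence :: "connective set \<Rightarrow> fm rel" where
  "middle_congruence \<Psi> = {(\<phi>, \<psi>). \<phi> \<in> Fm \<Psi> \<and> \<psi> \<in> Fm \<Psi> \<and>
     merge_middle (chain_val \<phi>) = merge_middle (chain_val \<psi>)}"

text \<open>This is the kernel of a homomorphism: \<open>chain_val\<close> followed by the collapse
  onto the chain 0 < 1 < 3.\<close>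

lemma congruence_middle_congruence: "congruence \<Psi> (middle_congruence \<Psi>)"
proof -
  have "equiv (Fm \<Psi>) (middle_congruence \<Psi>)"
    by (rule equivI) (auto simp: middle_congruence_def intro!: refl_onI symI transI)
  moreover have
    "merge_middle (chain_val (NegR \<phi>)) = (if merge_middle (chain_val \<phi>) = 0 then 3 else 0)"
    "merge_middle (chain_val (NegL \<phi>)) = (if merge_middle (chain_val \<phi>) = 0 then 3 else 0)"
    for \<phi>
    by (simp_all only: chain_val.simps merge_middle_neg)
  ultimately show ?thesis
    unfolding congruence_def
    by (intro conjI allI impI)
      (simp_all add: middle_congruence_def Fm_def merge_middle_max merge_middle_min
        del: chain_val.simps(7,8))
qed

text \<open>The top is not merged with any other value of the chain.\<close>

lemma compatible_middle_congruence:
  "compatible (middle_congruence \<Psi>) (filter_theory \<Psi> 3)"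
  by (auto simp: compatible_def middle_congruence_def filter_theory_def merge_middle_def
      split: if_splits)

lemma not_protoalgebraic_eFL: "\<not> protoalgebraic \<Psi> (eFL \<sigma> \<Psi>)"
proof
  assume "protoalgebraic \<Psi> (eFL \<sigma> \<Psi>)"
  moreover have "filter_theory \<Psi> 3 \<subseteq> filter_theory \<Psi> 2"
    by (auto simp: filter_theory_def)
  ultimately have "Leibniz \<Psi> (filter_theory \<Psi> 3) \<subseteq> Leibniz \<Psi> (filter_theory \<Psi> 2)"
    unfolding protoalgebraic_def by (simp add: is_theory_filter_theory)
  \<comment> \<open>Variables already realise both middle values, so the same two witnesses serve
    every language.\<close>
  moreover have "(Var 1, Var 0) \<in> middle_congruence \<Psi>"
    by (simp add: middle_congruence_def merge_middle_def Fm_def)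
  ultimately have "(Var 1, Var 0) \<in> Leibniz \<Psi> (filter_theory \<Psi> 2)"
    using Leibniz_greatest[OF congruence_middle_congruence compatible_middle_congruence] by blast
  moreover have "Var 1 \<in> filter_theory \<Psi> 2" "Var 0 \<notin> filter_theory \<Psi> 2"
    by (simp_all add: filter_theory_def Fm_def)
  ultimately show False
    using compatible_Leibniz unfolding compatible_def by blast
qed

theorem theorem29:
  fixes \<sigma> :: "structural set"
  shows "\<not> protoalgebraic {COr, CFus, CZero, COne} (eFL \<sigma> {COr, CFus, CZero, COne}) \<and>
    \<not> protoalgebraic {COr, CAnd, CFus, CZero, COne} (eFL \<sigma> {COr, CAnd, CFus, CZero, COne}) \<and>
    \<not> protoalgebraic {COr, CFus, CNegR, CNegL, CZero, COne}
        (eFL \<sigma> {COr, CFus, CNegR, CNegL, CZero, COne}) \<and>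
    \<not> protoalgebraic {COr, CAnd, CFus, CNegR, CNegL, CZero, COne}
        (eFL \<sigma> {COr, CAnd, CFus, CNegR, CNegL, CZero, COne})"
  by (simp add: not_protoalgebraic_eFL)

end
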